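(* Let $p(x),q(x)\in\mathbb{R}[x]$ be two monic polynomials of respective degrees $n$ and $n-1$ whose signed remainders sequence $\mathrm{SRemS}(p,q)$ has no degree breakdown. Consider the symmetric LU-decomposition $H_n(q/p)=KJK^T$ of the Hankel matrix $H_n(q/p)$, where $J\in\mathbb{R}^{n\times n}$ is a signature matrix and $K\in\mathbb{R}^{n\times n}$ is an (invertible) lower triangular matrix. Let $\tilde q(x)$ be the monic polynomial whose coefficients in the canonical basis $(1,x,\ldots,x^{n-1})$ are proportional to the last row of $K^{-1}$. Then $$\mathrm{Td}(p,\tilde q)=\overline{\mathrm{Td}(p,q)}.$$
   Context: Signed remainders sequence. For monic real polynomials $p,q$ of degrees $n$ and $n-1$, $\mathrm{SRemS}(p,q)=(p_k(x))_k$ is defined by $p_0=p$, $p_1=q$ and $p_k(x)=q_{k+1}(x)p_{k+1}(x)-\epsilon_{k+1}\beta_{k+1}^2p_{k+2}(x)$, where $q_{k+1}\in\mathbb{R}[x]$, $\epsilon_{k+1}\in\{-1,+1\}$, $\beta_{k+1}>0$ is real, $p_{k+2}$ is monic and $\deg p_{k+2}<\deg p_{k+1}$; the sequence stops just before the zero remainder is reached. It has no degree breakdown if $\deg p_k=n-k$ for all $k\in\{0,\ldots,n\}$. In that case $q_{k+1}(x)=x-\alpha_{k+1}$ with $\alpha_{k+1}\in\mathbb{R}$. Tridiagonal matrices. For real sequences $\alpha=(\alpha_1,\ldots,\alpha_n)$, $\beta=(\beta_1,\ldots,\beta_{n-1})$, $\gamma=(\gamma_1,\ldots,\gamma_{n-1})$,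 $\mathrm{Td}(\alpha,\beta,\gamma)\in\mathbb{R}^{n\times n}$ is the tridiagonal matrix whose diagonal is, from top to bottom, $\alpha_n,\alpha_{n-1},\ldots,\alpha_1$, whose first lower diagonal is, from top to bottom, $\beta_{n-1},\ldots,\beta_1$, and whose first upper diagonal is, from top to bottom, $\gamma_{n-1},\ldots,\gamma_1$. When $\mathrm{SRemS}(p,q)$ has no degree breakdown, $\mathrm{Td}(p,q)=\mathrm{Td}(\alpha,\beta,\gamma)$, where $\alpha_k\in\mathbb{R}$ ($1\le k\le n$) is given by the degree one quotient $q_k(x)=x-\alpha_k$ in $\mathrm{SRemS}(p,q)$, where $\beta_k>0$ and $\epsilon_k\in\{-1,+1\}$ ($1\le k\le n-1$) are the numbers in the relation $p_{k-1}(x)=q_k(x)p_k(x)-\epsilon_k\beta_k^2p_{k+1}(x)$ of $\mathrm{SRemS}(p,q)$, and $\gamma_k=\epsilon_k\beta_k$. Dual. Let $\bar q(x)=\det(x\,\mathrm{Id}_{n-1}-\overline{\mathrm{Td}}_{n-1})$, where $\overline{\mathrm{Td}}_{n-1}$ is the submatrix of $\mathrm{Td}(p,q)$ formed by its last $n-1$ rows and columns. Then $\mathrm{SRemS}(p,\bar q)$ also has no degree breakdown and $\overline{\mathrm{Td}(p,q)}$ denotes $\mathrm{Td}(p,\bar q)$. Hankel matrix. $H_n(q/p)=(s_{i+j})_{0\le i,j\le n-1}$, where $\frac{q(x)}{p(x)}=\sum_{j\ge 0}\frac{s_j}{x^{j+1}}$. The no-degree-breakdown assumption is equivalent to all leading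 principal minors of $H_n(q/p)$ being nonzero, so that a decomposition $H_n(q/p)=KJK^T$ with $J$ a signature matrix and $K$ an invertible lower triangular matrix exists. A signature matrix is a diagonal matrix with diagonal entries $\pm1$. *)

theory Defs
  imports
    "HOL-Computational_Algebra.Formal_Laurent_Series"
    "Jordan_Normal_Form.Char_Poly"
begin

hide_const (open) module.smult

subsection \<open>Signed remainders sequences\<close>

text \<open>One step p = Q q - e b^2 r of the signed remainders sequence.\<close>

definition srem_step ::
    "real poly \<Rightarrow> real poly \<Rightarrow> real poly \<Rightarrow> real \<Rightarrow> real \<Rightarrow> real poly \<Rightarrow> bool" where
  "srem_step p q Q e b r \<longleftrightarrow>
     p = Q * q - smult (e * b\<^sup>2) r \<and> e \<in> {-1, 1} \<and> b > 0 \<and>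
     monic r \<and> degree r < degree q"

definition srem_eps :: "real poly \<Rightarrow> real poly \<Rightarrow> real" where
  "srem_eps p q = - sgn (lead_coeff (p mod q))"

definition srem_beta :: "real poly \<Rightarrow> real poly \<Rightarrow> real" where
  "srem_beta p q = sqrt \<bar>lead_coeff (p mod q)\<bar>"

definition srem_next :: "real poly \<Rightarrow> real poly \<Rightarrow> real poly" where
  "srem_next p q = smult (inverse (lead_coeff (p mod q))) (p mod q)"

text \<open>
  Whenever the remainder does not vanish, the data of a step exist, are unique, and are
  the ones computed by the functions above.
\<close>

lemma srem_step_iff:
  assumes "q \<noteq> 0"
  shows "srem_step p q Q e b r \<longleftrightarrow>
    p mod q \<noteq> 0 \<and> Q = p div q \<and> e = srem_eps p q \<and> b = srem_beta p q \<and> r = srem_next p q"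
proof
  assume s: "srem_step p q Q e b r"
  have p: "p = Q * q + smult (- (e * b\<^sup>2)) r" and e: "e = -1 \<or> e = 1" and b: "b > 0"
    and r: "lead_coeff r = 1" and deg: "degree r < degree q"
    using s by (auto simp: srem_step_def)
  let ?r = "smult (- (e * b\<^sup>2)) r"
  have nz: "- (e * b\<^sup>2) \<noteq> 0" using e b by auto
  have dr: "degree ?r < degree q" using deg nz by simp
  have "(Q * q + R) mod q = R \<and> (Q * q + R) div q = Q" if "degree R < degree q" for R
    using that assms by (simp add: mod_poly_less div_poly_less)
  then have m: "p mod q = ?r" and d: "p div q = Q"
    using dr p by metis+
  have lc: "lead_coeff (p mod q) = - (e * b\<^sup>2)" by (simp only: m lead_coeff_smult r mult_1_right)
  have "r \<noteq> 0" using r by auto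
  then have "p mod q \<noteq> 0" using m nz by simp
  moreover have "e = srem_eps p q"
    unfolding srem_eps_def lc using e b by (auto simp: sgn_if)
  moreover have "b = srem_beta p q"
    unfolding srem_beta_def lc using e b by (auto simp: abs_mult)
  moreover have "r = srem_next p q"
    unfolding srem_next_def lc unfolding m smult_smult left_inverse[OF nz] by simp
  ultimately show "p mod q \<noteq> 0 \<and> Q = p div q \<and> e = srem_eps p q \<and> b = srem_beta p q
      \<and> r = srem_next p q" using d by simp
next
  assume *: "p mod q \<noteq> 0 \<and> Q = p div q \<and> e = srem_eps p q \<and> b = srem_beta p q \<and> r = srem_next p q"
  let ?c = "lead_coeff (p mod q)"
  have c: "?c \<noteq> 0" using * by simp
  have "- (e * b\<^sup>2) = ?c"
    using * by (simp add: srem_eps_def srem_beta_def sgn_mult_abs)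
  then have eb: "e * b\<^sup>2 = - ?c" by linarith
  have r: "r = smult (inverse ?c) (p mod q)" using * by (simp add: srem_next_def)
  have "smult (e * b\<^sup>2) r = - (p mod q)"
    unfolding eb r smult_smult using c by simp
  then have "p = Q * q - smult (e * b\<^sup>2) r" using * by simp
  moreover have "e \<in> {-1, 1}" using * c by (simp add: srem_eps_def sgn_if)
  moreover have "b > 0" using * c by (simp add: srem_beta_def)
  moreover have "lead_coeff r = 1" using * c by (simp add: srem_next_def)
  moreover have "degree r < degree q"
    using * c assms degree_mod_less[of q p] by (simp add: srem_next_def)
  ultimately show "srem_step p q Q e b r" by (simp add: srem_step_def)
qed

text \<open>The list of all terms, which ends just before the zero remainder.\<close>

function SRemS :: "real poly \<Rightarrow> real poly \<Rightarrow> real poly list" where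
  "SRemS p q = (if q = 0 then [p] else p # SRemS q (srem_next p q))"
  by pat_completeness auto

termination
proof (relation "measure (\<lambda>(p, q). if q = 0 then 0 else Suc (degree q))", goal_cases)
  case (2 p q)
  then show ?case
    using degree_mod_less[of q p] by (auto simp: srem_next_def)
qed simp

declare SRemS.simps [simp del]

definition no_degree_breakdown :: "real poly \<Rightarrow> real poly \<Rightarrow> bool" where
  "no_degree_breakdown p q \<longleftrightarrow>
     (\<forall>k\<le>degree p. k < length (SRemS p q) \<and> degree (SRemS p q ! k) = degree p - k)"

subsection \<open>Tridiagonal matrices\<close>

text \<open>
  The parameters of the step from the terms of index k - 1 and k (for k at least 1).
  The quotient is x - alpha when there is no degree breakdown.
\<close>

definition seq_alpha :: "real poly \<Rightarrow> real poly \<Rightarrow> nat \<Rightarrow> real" where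
  "seq_alpha p q k = - coeff (SRemS p q ! (k - 1) div SRemS p q ! k) 0"

definition seq_beta :: "real poly \<Rightarrow> real poly \<Rightarrow> nat \<Rightarrow> real" where
  "seq_beta p q k = srem_beta (SRemS p q ! (k - 1)) (SRemS p q ! k)"

definition seq_eps :: "real poly \<Rightarrow> real poly \<Rightarrow> nat \<Rightarrow> real" where
  "seq_eps p q k = srem_eps (SRemS p q ! (k - 1)) (SRemS p q ! k)"

lemma SRemS_nth_step:
  assumes "1 \<le> k" "Suc k < length (SRemS p q)"
  shows "srem_step (SRemS p q ! (k - 1)) (SRemS p q ! k)
    (SRemS p q ! (k - 1) div SRemS p q ! k) (seq_eps p q k) (seq_beta p q k) (SRemS p q ! Suc k)"
  using assms
proof (induction p q arbitrary: k rule: SRemS.induct)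
  case (1 p q)
  have q: "q \<noteq> 0" using 1(2,3) SRemS.simps[of p q] by auto
  have S: "SRemS p q = p # SRemS q (srem_next p q)" using q SRemS.simps[of p q] by simp
  have hd: "SRemS a b ! 0 = a" for a b by (subst SRemS.simps) simp
  show ?case
  proof (cases "k = 1")
    case True
    have len: "1 < length (SRemS q (srem_next p q))" using 1(3) S True by simp
    then have nz: "srem_next p q \<noteq> 0" using SRemS.simps[of q "srem_next p q"] by auto
    then have m: "p mod q \<noteq> 0" by (auto simp: srem_next_def)
    have "SRemS q (srem_next p q) ! 1 = srem_next p q"
      using nz SRemS.simps[of q "srem_next p q"] hd by simp
    then show ?thesis
      using True m q by (simp add: srem_step_iff S hd seq_eps_def seq_beta_def)
  next
    case False
    then obtain l where l: "k = Suc l" "1 \<le> l" using 1(2) by (cases k) auto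
    then obtain l' where l': "l = Suc l'" by (cases l) auto
    show ?thesis
      using 1(1)[OF q, of l] 1(3) l l' by (simp add: S seq_eps_def seq_beta_def)
  qed
qed

text \<open>
  The sequences are indexed from 1, the rows and columns of matrices from 0; the indices of
  the sequences decrease from top to bottom.
\<close>

definition tridiag :: "nat \<Rightarrow> (nat \<Rightarrow> real) \<Rightarrow> (nat \<Rightarrow> real) \<Rightarrow> (nat \<Rightarrow> real) \<Rightarrow> real mat" where
  "tridiag n \<alpha> \<beta> \<gamma> = mat n n (\<lambda>(i, j).
     if i = j then \<alpha> (n - i)
     else if i = Suc j then \<beta> (n - 1 - j)
     else if j = Suc i then \<gamma> (n - 1 - i)
     else 0)"

definition Td :: "real poly \<Rightarrow> real poly \<Rightarrow> real mat" where
  "Td p q = tridiag (degree p) (seq_alpha p q) (seq_beta p q)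
     (\<lambda>k. seq_eps p q k * seq_beta p q k)"

definition dual_poly :: "real poly \<Rightarrow> real poly \<Rightarrow> real poly" where
  "dual_poly p q = char_poly (mat_delete (Td p q) 0 0)"

definition dual_Td :: "real poly \<Rightarrow> real poly \<Rightarrow> real mat" where
  "dual_Td p q = Td p (dual_poly p q)"

subsection \<open>Hankel matrices\<close>

text \<open>
  The expansion of q(x) / p(x) in powers of 1/x, as a formal Laurent series whose
  variable is 1/x, so that x becomes the inverse of the variable.
\<close>

definition expansion_at_infinity :: "real poly \<Rightarrow> real poly \<Rightarrow> real fls" where
  "expansion_at_infinity q p =
     poly (map_poly fls_const q) fls_X_inv / poly (map_poly fls_const p) fls_X_inv"

definition hankel_mat :: "nat \<Rightarrow> real poly \<Rightarrow> real poly \<Rightarrow> real mat" where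
  "hankel_mat n q p =
     mat n n (\<lambda>(i, j). fls_nth (expansion_at_infinity q p) (int (i + j) + 1))"

definition signature_mat :: "real mat \<Rightarrow> bool" where
  "signature_mat J \<longleftrightarrow> square_mat J \<and> diagonal_mat J \<and> (\<forall>i<dim_row J. J $$ (i, i) \<in> {-1, 1})"

definition lower_triangular :: "real mat \<Rightarrow> bool" where
  "lower_triangular K \<longleftrightarrow> upper_triangular (transpose_mat K)"

end

theory Submission
  imports Defs
begin

text \<open>
  Expanding determinants along the first column, the characteristic polynomials \<open>r\<^sub>k\<close> of the trailing
  \<open>k \<times> k\<close> blocks of \<open>Td(p, q)\<close> satisfy the three-term recurrence
  \<open>r\<^sub>k = (x - \<alpha>\<^sub>k) r\<^bsub>k-1\<^esub> - \<epsilon>\<^bsub>k-1\<^esub> \<beta>\<^bsub>k-1\<^esub>\<^sup>2 r\<^bsub>k-2\<^esub>\<close>, whose coefficients are those of the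
  signed remainders sequence, met in the opposite order (\<open>char_poly_tridiag\<close>). By definition the
  dual polynomial is \<open>r\<^bsub>n-1\<^esub>\<close>.

  Two classical identities for continuants (\<open>jacobi_poly_duality\<close>) then carry the proof. First,
  \<open>r\<^sub>n = p\<close>; hence the recurrence read downwards from \<open>r\<^sub>n\<close> is the signed remainders sequence of
  \<open>p\<close> and the dual polynomial, so that the latter pair has no degree breakdown either. Second,
  \<open>r\<^bsub>n-1\<^esub> q\<close> is congruent modulo \<open>p\<close> to the constant \<open>\<Prod>\<^sub>i \<epsilon>\<^sub>i \<beta>\<^sub>i\<^sup>2 \<noteq> 0\<close>: up to scaling,
  the dual polynomial is the inverse of \<open>q\<close> modulo \<open>p\<close>.

  It remains to see that \<open>q'\<close> has the same property, since such an inverse is unique once it is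
  monic. Write \<open>H\<close> for the Hankel matrix and \<open>L\<close> for the inverse of \<open>K\<close>. Then \<open>L H = J K\<^sup>T\<close> is
  upper triangular, so its last row vanishes outside the diagonal
  (\<open>last_row_inverse_factor_orthogonal\<close>). The off-diagonal entries of this row are, up to a common
  factor, the coefficients of \<open>x\<^bsup>-1\<^esup>, \<dots>, x\<^bsup>1-n\<^esup>\<close> in the expansion of \<open>q' q / p\<close> at infinity. But the
  fractional part of \<open>q' q / p\<close> is the remainder of \<open>q' q\<close> modulo \<open>p\<close> divided by \<open>p\<close>, and a
  nonconstant remainder would give a nonzero coefficient in this range
  (\<open>product_mod_constant_of_vanishing_moments\<close>). So \<open>q'\<close> is the dual polynomial itself, and the
  equality of the two tridiagonal matrices is immediate.
\<close>

section \<open>Continuants of tridiagonal matrices\<close>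

text \<open>
  The characteristic polynomials of a growing Jacobi matrix with diagonal \<open>a\<close>, where \<open>c\<close> consists of
  the products of opposite off-diagonal entries. Both sequences start at index 1.
\<close>

fun jacobi_poly :: "(nat \<Rightarrow> 'a :: comm_ring_1) \<Rightarrow> (nat \<Rightarrow> 'a) \<Rightarrow> nat \<Rightarrow> 'a poly" where
  "jacobi_poly a c 0 = 1"
| "jacobi_poly a c (Suc 0) = [:- a 1, 1:]"
| "jacobi_poly a c (Suc (Suc k)) =
     [:- a (Suc (Suc k)), 1:] * jacobi_poly a c (Suc k)
     - smult (c (Suc k)) (jacobi_poly a c k)"

lemma jacobi_poly_degree_monic:
  fixes a c :: "nat \<Rightarrow> 'a :: idom"
  shows "degree (jacobi_poly a c k) = k \<and> monic (jacobi_poly a c k)"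
proof (induction k rule: induct_nat_012)
  case (ge2 k)
  note IH = ge2
  let ?f = "[:- a (Suc (Suc k)), 1:] * jacobi_poly a c (Suc k)"
  let ?g = "- smult (c (Suc k)) (jacobi_poly a c k)"
  have nz: "jacobi_poly a c (Suc k) \<noteq> 0" using IH by force
  have deg: "degree ?f = Suc (Suc k)"
    using IH nz by (subst degree_mult_eq) auto
  have lc: "lead_coeff (jacobi_poly a c (Suc k)) = 1" using IH by blast
  have lead: "lead_coeff ?f = 1" unfolding lead_coeff_mult lc by simp
  have small: "degree ?g < degree ?f"
    using IH degree_smult_le[of "c (Suc k)" "jacobi_poly a c k"] unfolding deg degree_minus by linarith
  have "jacobi_poly a c (Suc (Suc k)) = ?f + ?g" by simp
  then show ?case
    using degree_add_eq_left[OF small] deg lead coeff_eq_0[OF small] by (simp only: coeff_add add_0_right)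
qed auto

lemma tridiag_carrier [simp]: "tridiag m \<alpha> \<beta> \<gamma> \<in> carrier_mat m m"
  by (simp add: tridiag_def)

text \<open>
  Indices of the sequences count from the bottom right corner, so that removing the first row and
  column leaves the sequences unchanged.
\<close>

lemma mat_delete_tridiag:
  "mat_delete (tridiag m \<alpha> \<beta> \<gamma>) 0 0 = tridiag (m - 1) \<alpha> \<beta> \<gamma>"
  by (rule eq_matI) (auto simp: mat_delete_def tridiag_def intro!: arg_cong[of _ _ \<alpha>] arg_cong[of _ _ \<beta>] arg_cong[of _ _ \<gamma>])

lemma char_poly_tridiag_rec:
  "char_poly (tridiag (Suc (Suc m)) \<alpha> \<beta> \<gamma>) =
     [:- \<alpha> (Suc (Suc m)), 1:] * char_poly (tridiag (Suc m) \<alpha> \<beta> \<gamma>)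
     - smult (\<beta> (Suc m) * \<gamma> (Suc m)) (char_poly (tridiag m \<alpha> \<beta> \<gamma>))"
proof -
  define M where "M m = char_poly_matrix (tridiag m \<alpha> \<beta> \<gamma>)" for m
  have M: "M m \<in> carrier_mat m m" for m by (simp add: M_def)
  have entry: "M m $$ (i, j) =
      (if i = j then [:- \<alpha> (m - i), 1:]
       else if i = Suc j then [:- \<beta> (m - 1 - j):]
       else if j = Suc i then [:- \<gamma> (m - 1 - i):] else 0)"
    if "i < m" "j < m" for m i j
    using that by (auto simp: M_def char_poly_matrix_def tridiag_def)
  \<comment> \<open>The first column has at most two nonzero entries; the minor \<open>B\<close> of the second has at most one nonzero
    entry in its first row, whose minor in \<open>B\<close> is \<open>M m\<close>.\<close>
  let ?A = "M (Suc (Suc m))"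
  define B where "B = mat_delete ?A 1 0"
  have B: "B \<in> carrier_mat (Suc m) (Suc m)"
    using mat_delete_carrier[OF M[of "Suc (Suc m)"]] by (simp add: B_def)
  have del: "mat_delete ?A 0 0 = M (Suc m)"
    using M by (intro eq_matI) (auto simp: mat_delete_def entry carrier_matD[OF M])
  have delB: "mat_delete B 0 0 = M m"
    using M by (intro eq_matI) (auto simp: B_def mat_delete_def entry carrier_matD[OF M])
  have B0: "B $$ (0, j) = (if j = 0 then [:- \<gamma> (Suc m):] else 0)" if "j < Suc m" for j
    using that by (auto simp: B_def mat_delete_def entry carrier_matD[OF M])
  have "det B = (\<Sum>j<Suc m. B $$ (0, j) * cofactor B 0 j)"
    by (rule laplace_expansion_row[OF B]) simp
  also have "\<dots> = (\<Sum>j<Suc m. if j = 0 then [:- \<gamma> (Suc m):] * cofactor B 0 0 else 0)"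
    by (intro sum.cong refl) (simp add: B0)
  also have "\<dots> = [:- \<gamma> (Suc m):] * det (M m)"
    by (simp add: cofactor_def delB del: sum.lessThan_Suc)
  finally have detB: "det B = [:- \<gamma> (Suc m):] * det (M m)" .
  have "det ?A = (\<Sum>i<Suc (Suc m). ?A $$ (i, 0) * cofactor ?A i 0)"
    by (rule laplace_expansion_column[OF M]) simp
  also have "\<dots> = (\<Sum>i\<in>{0, 1}. ?A $$ (i, 0) * cofactor ?A i 0)"
    by (intro sum.mono_neutral_right) (auto simp: entry)
  also have "\<dots> = [:- \<alpha> (Suc (Suc m)), 1:] * det (M (Suc m)) - [:- \<beta> (Suc m):] * det B"
    using B_def by (simp add: entry cofactor_def del)
  finally show ?thesis unfolding detB by (simp add: char_poly_def M_def mult.commute)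
qed

lemma char_poly_tridiag:
  "char_poly (tridiag m \<alpha> \<beta> \<gamma>) = jacobi_poly \<alpha> (\<lambda>k. \<beta> k * \<gamma> k) m"
proof (induction m rule: induct_nat_012)
  case 0
  show ?case by (simp add: char_poly_def char_poly_matrix_def tridiag_def)
next
  case 1
  show ?case
    by (simp add: char_poly_def char_poly_matrix_def tridiag_def det_single)
next
  case (ge2 m)
  then show ?case by (simp only: char_poly_tridiag_rec jacobi_poly.simps)
qed

section \<open>Two directions of a three-term recurrence\<close>

text \<open>
  The sequence \<open>P\<close> runs downwards and the polynomials \<open>jacobi_poly a c\<close> run upwards with the same
  coefficients. Rewriting \<open>P (Suc k)\<close> by its recurrence shifts the coefficients from one sequence
  to the other, which makes the right-hand side independent of \<open>k\<close>. This is the expansion of a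
  tridiagonal determinant from the middle.
\<close>

lemma jacobi_poly_telescope:
  fixes P :: "nat \<Rightarrow> 'a :: comm_ring_1 poly"
  assumes rec: "\<And>k. k < n \<Longrightarrow>
      P k = [:- a (Suc k), 1:] * P (Suc k) - smult (c (Suc k)) (P (Suc (Suc k)))"
    and "k < n"
  shows "P 0 = jacobi_poly a c (Suc k) * P (Suc k)
    - smult (c (Suc k)) (jacobi_poly a c k * P (Suc (Suc k)))"
  using \<open>k < n\<close>
proof (induction k)
  case 0
  then show ?case using rec[of 0] by simp
next
  case (Suc k)
  let ?r = "jacobi_poly a c"
  have "P 0 = ?r (Suc k) * P (Suc k) - smult (c (Suc k)) (?r k * P (Suc (Suc k)))"
    using Suc by simp
  also have "P (Suc k) = [:- a (Suc (Suc k)), 1:] * P (Suc (Suc k))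
      - smult (c (Suc (Suc k))) (P (Suc (Suc (Suc k))))"
    using Suc.prems by (rule rec)
  finally show ?case
    by (simp only: jacobi_poly.simps algebra_simps smult_diff_right mult_smult_left mult_smult_right)
qed

text \<open>
  Modulo \<open>P 0\<close>, the products \<open>jacobi_poly a c k * P 1\<close> and the terms \<open>P (Suc k)\<close>, rescaled by
  \<open>c 1 \<cdots> c k\<close>, obey the same three-term recurrence and have the same initial values.
\<close>

lemma jacobi_poly_times_second_term:
  fixes P :: "nat \<Rightarrow> 'a :: comm_ring_1 poly"
  assumes rec: "\<And>k. k < n \<Longrightarrow>
      P k = [:- a (Suc k), 1:] * P (Suc k) - smult (c (Suc k)) (P (Suc (Suc k)))"
    and "k < n"
  shows "P 0 dvd jacobi_poly a c k * P 1 - smult (\<Prod>i=1..k. c i) (P (Suc k))"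
  using \<open>k < n\<close>
proof (induction k rule: induct_nat_012)
  case 0
  then show ?case by simp
next
  case 1
  then show ?case using rec[of 0] by simp
next
  case (ge2 k)
  let ?r = "jacobi_poly a c" and ?C = "\<lambda>k. \<Prod>i=1..k. c i"
  let ?D = "\<lambda>k. ?r k * P 1 - smult (?C k) (P (Suc k))"
  have C: "?C (Suc j) = ?C j * c (Suc j)" for j by simp
  have "[:- a (Suc (Suc k)), 1:] * P (Suc (Suc k))
      = P (Suc k) + smult (c (Suc (Suc k))) (P (Suc (Suc (Suc k))))"
    using rec[of "Suc k"] ge2.prems by simp
  then have "smult (?C (Suc k)) ([:- a (Suc (Suc k)), 1:] * P (Suc (Suc k)))
      = smult (?C (Suc k)) (P (Suc k) + smult (c (Suc (Suc k))) (P (Suc (Suc (Suc k)))))"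
    by simp
  then have "?D (Suc (Suc k)) = [:- a (Suc (Suc k)), 1:] * ?D (Suc k) - smult (c (Suc k)) (?D k)"
    unfolding C jacobi_poly.simps
    by (simp only: algebra_simps smult_diff_right smult_add_right mult_smult_left mult_smult_right smult_smult)
  then show ?case using ge2 by (simp only: Suc_lessD dvd_diff dvd_mult dvd_smult)
qed

text \<open>
  The case where \<open>P\<close> ends with \<open>1, 0\<close>, as a sequence of remainders does: \<open>P 0\<close> is then itself
  the last continuant, and the preceding one inverts \<open>P 1\<close> modulo \<open>P 0\<close> up to a constant factor.
\<close>

lemma jacobi_poly_duality:
  fixes P :: "nat \<Rightarrow> 'a :: comm_ring_1 poly"
  assumes rec: "\<And>k. k < n \<Longrightarrow>
      P k = [:- a (Suc k), 1:] * P (Suc k) - smult (c (Suc k)) (P (Suc (Suc k)))"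
    and "n \<ge> 1" "P n = 1" "P (Suc n) = 0"
  shows "jacobi_poly a c n = P 0"
    and "P 0 dvd jacobi_poly a c (n - 1) * P 1 - [:\<Prod>i=1..n-1. c i:]"
proof -
  obtain m where n: "n = Suc m" using \<open>n \<ge> 1\<close> by (cases n) auto
  show "jacobi_poly a c n = P 0"
    using jacobi_poly_telescope[of n P a c m, OF rec] assms n by simp
  show "P 0 dvd jacobi_poly a c (n - 1) * P 1 - [:\<Prod>i=1..n-1. c i:]"
    using jacobi_poly_times_second_term[of n P a c m, OF rec] assms n by simp
qed

section \<open>Signed remainders sequences and their duals\<close>

lemma SRemS_nth_0: "SRemS p q ! 0 = p"
  by (subst SRemS.simps) simp

lemma SRemS_nth_1: "q \<noteq> 0 \<Longrightarrow> SRemS p q ! Suc 0 = q"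
  by (subst SRemS.simps) (simp add: SRemS_nth_0)

text \<open>
  A sequence that obeys the recursion step of the signed remainders sequence is recognised as
  that sequence; the length bound ensures that the latter does not stop earlier.
\<close>

lemma SRemS_nth_eqI:
  assumes "\<And>k. k \<le> n \<Longrightarrow> f k \<noteq> 0"
    and "\<And>k. Suc (Suc k) \<le> n \<Longrightarrow> f (Suc (Suc k)) = srem_next (f k) (f (Suc k))"
    and "n \<ge> 1" and "k \<le> n"
  shows "k < length (SRemS (f 0) (f 1)) \<and> SRemS (f 0) (f 1) ! k = f k"
  using assms
proof (induction k arbitrary: f n)
  case 0
  show ?case by (simp add: SRemS_nth_0) (subst SRemS.simps, simp)
next
  case (Suc k)
  have S: "SRemS (f 0) (f 1) = f 0 # SRemS (f 1) (srem_next (f 0) (f 1))"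
    using Suc.prems by (subst SRemS.simps) simp
  show ?case
  proof (cases k)
    case 0
    have "SRemS (f 1) g \<noteq> []" for g by (subst SRemS.simps) simp
    then show ?thesis using 0 S by (simp add: SRemS_nth_0)
  next
    case (Suc j)
    have next2: "srem_next (f 0) (f 1) = f 2"
      using Suc.prems(2)[of 0] Suc.prems(4) Suc by (simp add: numeral_2_eq_2)
    have "k < length (SRemS (f (Suc 0)) (f (Suc 1))) \<and>
        SRemS (f (Suc 0)) (f (Suc 1)) ! k = f (Suc k)"
      using Suc.prems Suc by (intro Suc.IH[of "n - 1" "\<lambda>i. f (Suc i)"]) auto
    then show ?thesis using S next2 by (simp add: numeral_2_eq_2)
  qed
qed

lemma degree_lead_coeff_div:
  fixes f g :: "'a :: field poly"
  assumes "g \<noteq> 0" "degree g < degree f"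
  shows "degree f = degree (f div g) + degree g"
    and "lead_coeff f = lead_coeff (f div g) * lead_coeff g"
proof -
  have small: "degree (f mod g) < degree f"
    using degree_mod_less[OF \<open>g \<noteq> 0\<close>, of f] assms by auto
  have f: "f = f mod g + f div g * g" by simp
  have "degree (f mod g) < degree (f div g * g)"
  proof (rule ccontr)
    assume "\<not> degree (f mod g) < degree (f div g * g)"
    then have "degree (f mod g + f div g * g) \<le> degree (f mod g)"
      by (intro degree_add_le) auto
    then show False using small by simp
  qed
  then have eq: "degree f = degree (f div g * g)" "lead_coeff f = lead_coeff (f div g * g)"
    using degree_add_eq_right[of "f mod g" "f div g * g"] lead_coeff_add_le[of "f mod g" "f div g * g"]
    by (simp_all only: f[symmetric])
  then have "f div g \<noteq> 0" using assms by auto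
  then show "degree f = degree (f div g) + degree g"
    using eq \<open>g \<noteq> 0\<close> by (simp add: degree_mult_eq)
  show "lead_coeff f = lead_coeff (f div g) * lead_coeff g"
    unfolding eq(2) by (rule lead_coeff_mult)
qed

text \<open>
  Extending the sequence by a zero brings the final exact division into the form of the other
  ones. Signs and positivity are stated below index \<open>n\<close> only: the zero remainder makes
  \<open>seq_eps p q n\<close> and \<open>seq_beta p q n\<close> vanish.
\<close>

lemma no_degree_breakdown_recurrence:
  assumes "n \<ge> 1" "degree p = n" "monic p" "degree q = n - 1" "monic q"
    and nb: "no_degree_breakdown p q"
  obtains P where "P 0 = p" "P 1 = q" "P n = 1" "P (Suc n) = 0"
    "\<And>k. k < n \<Longrightarrow> P k = [:- seq_alpha p q (Suc k), 1:] * P (Suc k)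
       - smult (seq_eps p q (Suc k) * (seq_beta p q (Suc k))\<^sup>2) (P (Suc (Suc k)))"
    "\<And>k. k \<in> {1..<n} \<Longrightarrow> seq_eps p q k \<in> {-1, 1} \<and> seq_beta p q k > 0"
proof -
  let ?S = "SRemS p q"
  have q0: "q \<noteq> 0" using \<open>monic q\<close> by auto
  have len: "k < length ?S" and deg: "degree (?S ! k) = n - k" if "k \<le> n" for k
    using nb that assms by (auto simp: no_degree_breakdown_def)
  have step: "srem_step (?S ! k) (?S ! Suc k) (?S ! k div ?S ! Suc k)
      (seq_eps p q (Suc k)) (seq_beta p q (Suc k)) (?S ! Suc (Suc k))" if "Suc k < n" for k
    using SRemS_nth_step[of "Suc k" p q] len[of "Suc (Suc k)"] that by simp
  have monic: "monic (?S ! k)" if "k \<le> n" for k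
  proof -
    consider "k = 0" | "k = 1" | j where "k = Suc (Suc j)"
      by (metis One_nat_def not0_implies_Suc)
    then show ?thesis
    proof cases
      case 3
      then show ?thesis using step[of j] that by (simp add: srem_step_def)
    qed (use assms q0 in \<open>auto simp: SRemS_nth_0 SRemS_nth_1\<close>)
  qed
  define P where "P k = (if k \<le> n then ?S ! k else 0)" for k
  have Pn: "P n = 1"
    using monic[of n] deg[of n] monic_degree_0[of "?S ! n"] by (simp add: P_def)
  have eq: "?S ! k = (?S ! k div ?S ! Suc k) * ?S ! Suc k
      - smult (seq_eps p q (Suc k) * (seq_beta p q (Suc k))\<^sup>2) (P (Suc (Suc k)))"
    if "k < n" for k
  proof (cases "Suc k < n")
    case True
    then show ?thesis using step[OF True] by (simp add: srem_step_def P_def)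
  next
    case False
    then have "Suc k = n" using that by simp
    then show ?thesis using Pn by (auto simp: P_def)
  qed
  have quot: "?S ! k div ?S ! Suc k = [:- seq_alpha p q (Suc k), 1:]" if "k < n" for k
  proof -
    let ?f = "?S ! k" and ?g = "?S ! Suc k"
    let ?Q = "?f div ?g"
    have g: "monic ?g" "degree ?g = n - Suc k" and f: "monic ?f" "degree ?f = n - k"
      using that monic deg by auto
    have g0: "?g \<noteq> 0" using g by auto
    have "degree ?g < degree ?f" using f g that by simp
    then have Q: "degree ?Q = 1" "lead_coeff ?Q = 1"
      using f g g0 that degree_lead_coeff_div[of ?g ?f] by auto
    obtain u v where uv: "?Q = [:u, v:]" "v \<noteq> 0" by (rule degree1_coeffs[OF Q(1)])
    then have "v = 1" using Q(2) by simp
    then show ?thesis by (simp add: seq_alpha_def uv(1))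
  qed
  show ?thesis
  proof (rule that[of P])
    show "P 0 = p" "P 1 = q" "P n = 1" "P (Suc n) = 0"
      using assms q0 Pn by (auto simp: P_def SRemS_nth_0 SRemS_nth_1)
    show "P k = [:- seq_alpha p q (Suc k), 1:] * P (Suc k)
       - smult (seq_eps p q (Suc k) * (seq_beta p q (Suc k))\<^sup>2) (P (Suc (Suc k)))" if "k < n" for k
      using eq[OF that] quot[OF that] that by (simp add: P_def)
    show "seq_eps p q k \<in> {-1, 1} \<and> seq_beta p q k > 0" if "k \<in> {1..<n}" for k
      using step[of "k - 1"] that by (auto simp: srem_step_def)
  qed
qed

text \<open>
  The recurrence of \<open>jacobi_poly\<close>, read downwards, is a chain of signed division steps in which the
  degree drops by exactly one; uniqueness of the data of a step identifies it with the signed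
  remainders sequence of its first two terms.
\<close>

lemma jacobi_poly_no_degree_breakdown:
  fixes a e b :: "nat \<Rightarrow> real"
  assumes "n \<ge> 1" and eb: "\<And>k. k \<in> {1..<n} \<Longrightarrow> e k \<in> {-1, 1} \<and> b k > 0"
  defines "r \<equiv> jacobi_poly a (\<lambda>k. e k * (b k)\<^sup>2)"
  shows "no_degree_breakdown (r n) (r (n - 1))"
proof -
  define f where "f k = r (n - k)" for k
  have deg: "degree (r k) = k" and monic: "monic (r k)" for k
    using jacobi_poly_degree_monic unfolding r_def by blast+
  have nz: "r k \<noteq> 0" for k using monic[of k] by auto
  have "srem_next (f k) (f (Suc k)) = f (Suc (Suc k))" if k: "Suc (Suc k) \<le> n" for k
  proof -
    obtain j where j: "n - k = Suc (Suc j)" "n - Suc k = Suc j" "n - Suc (Suc k) = j"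
      using k by (metis Suc_diff_Suc Suc_le_lessD Suc_lessD)
    have "srem_step (r (Suc (Suc j))) (r (Suc j)) [:- a (Suc (Suc j)), 1:] (e (Suc j)) (b (Suc j)) (r j)"
      using eb[of "Suc j"] j k monic deg by (auto simp: srem_step_def r_def)
    then show ?thesis using srem_step_iff[OF nz] j by (simp add: f_def)
  qed
  then have "k < length (SRemS (f 0) (f 1)) \<and> SRemS (f 0) (f 1) ! k = f k" if "k \<le> n" for k
    using that \<open>n \<ge> 1\<close> nz by (intro SRemS_nth_eqI[of n f]) (auto simp: f_def)
  then show ?thesis by (simp add: no_degree_breakdown_def f_def deg)
qed

section \<open>Expansions at infinity\<close>

text \<open>
  The embedding of polynomials into Laurent series in \<open>1/x\<close> that underlies
  \<open>expansion_at_infinity\<close>: the power \<open>x\<^sup>i\<close> has index \<open>- i\<close>.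
\<close>

definition poly_at_infinity :: "'a :: comm_ring_1 poly \<Rightarrow> 'a fls" where
  "poly_at_infinity f = poly (map_poly fls_const f) fls_X_inv"

lemma poly_at_infinity_altdef:
  "poly_at_infinity f = (\<Sum>i\<le>degree f. fls_const (coeff f i) * fls_X_inv ^ i)"
proof -
  have "degree (map_poly fls_const f) = degree f"
    by (intro degree_map_poly) auto
  then show ?thesis by (simp add: poly_at_infinity_def poly_altdef coeff_map_poly)
qed

lemma fls_nth_poly_at_infinity:
  "fls_nth (poly_at_infinity f) k = (if k \<le> 0 then coeff f (nat (- k)) else 0)"
proof -
  have "fls_nth (poly_at_infinity f) k
      = (\<Sum>i\<le>degree f. if i = nat (- k) \<and> k \<le> 0 then coeff f i else 0)"
    unfolding poly_at_infinity_altdef fls_nth_sum by (intro sum.cong) auto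
  also have "\<dots> = (if k \<le> 0 then coeff f (nat (- k)) else 0)"
    by (auto simp: coeff_eq_0)
  finally show ?thesis .
qed

lemma poly_at_infinity_add: "poly_at_infinity (f + g) = poly_at_infinity f + poly_at_infinity g"
  by (rule fls_eqI) (simp add: fls_nth_poly_at_infinity)

lemma poly_at_infinity_mult: "poly_at_infinity (f * g) = poly_at_infinity f * poly_at_infinity g"
proof -
  have sum: "fls_const (sum h A) = (\<Sum>i\<in>A. fls_const (h i))" for h :: "nat \<Rightarrow> 'a" and A
    by (rule fls_eqI) (simp add: fls_nth_sum)
  have "map_poly fls_const (f * g) = map_poly fls_const f * map_poly fls_const g"
    by (rule poly_eqI) (simp add: coeff_map_poly coeff_mult sum)
  then show ?thesis by (simp add: poly_at_infinity_def)
qed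

lemma fls_subdegree_poly_at_infinity:
  "f \<noteq> 0 \<Longrightarrow> fls_subdegree (poly_at_infinity f) = - int (degree f)"
  by (rule fls_subdegree_eqI) (auto simp: fls_nth_poly_at_infinity coeff_eq_0)

lemma fls_nth_poly_at_infinity_mult:
  "fls_nth (poly_at_infinity f * F) k = (\<Sum>i\<le>degree f. coeff f i * fls_nth F (k + int i))"
  unfolding poly_at_infinity_altdef sum_distrib_right fls_nth_sum
  by (simp add: mult.assoc fls_X_inv_power_times_conv_shift(1))

text \<open>
  Let \<open>R\<close> be the remainder of \<open>f q\<close> modulo \<open>p\<close>. The expansion of \<open>f q / p\<close> is that of \<open>R / p\<close> plus a
  polynomial, and the latter contributes nothing to negative powers of \<open>x\<close>. The expansion of \<open>R / p\<close>
  starts with the power \<open>deg R - deg p\<close>, so if all moments below \<open>deg p - 1\<close> vanish, then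
  \<open>deg R\<close> cannot be positive.
\<close>

lemma product_mod_constant_of_vanishing_moments:
  assumes "p \<noteq> 0"
    and zero: "\<And>j. j < degree p - 1 \<Longrightarrow>
      (\<Sum>i\<le>degree f. coeff f i * fls_nth (expansion_at_infinity q p) (int (i + j) + 1)) = 0"
  shows "degree ((f * q) mod p) = 0"
proof (rule ccontr)
  let ?E = "expansion_at_infinity q p" and ?e = "poly_at_infinity :: real poly \<Rightarrow> real fls"
  define R where "R = (f * q) mod p"
  define A where "A = (f * q) div p"
  assume "degree ((f * q) mod p) \<noteq> 0"
  then have R: "degree R > 0" "R \<noteq> 0" by (auto simp: R_def)
  have dR: "degree R < degree p"
    using degree_mod_less[OF \<open>p \<noteq> 0\<close>, of "f * q"] R by (auto simp: R_def)
  have p0: "?e p \<noteq> 0"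
    using fls_nth_poly_at_infinity[of p "- int (degree p)"] \<open>p \<noteq> 0\<close> by auto
  have R0: "?e R \<noteq> 0"
    using fls_nth_poly_at_infinity[of R "- int (degree R)"] R by auto
  have "f * q = A * p + R" by (simp add: A_def R_def)
  then have "?e f * ?e q = ?e A * ?e p + ?e R"
    by (simp only: flip: poly_at_infinity_add poly_at_infinity_mult)
  then have "?e f * (?e q / ?e p) = ?e A + ?e R / ?e p"
    using p0 by (simp add: field_simps)
  then have eq: "?e f * ?E = ?e A + ?e R / ?e p"
    by (simp add: expansion_at_infinity_def poly_at_infinity_def)
  \<comment> \<open>The moment given by the leading term of \<open>R / p\<close>.\<close>
  define j where "j = degree p - degree R - 1"
  have j: "j < degree p - 1" "int j + 1 = int (degree p) - int (degree R)"
    using dR R by (auto simp: j_def)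
  have "fls_subdegree (?e R / ?e p) = int j + 1"
    using fls_divide_subdegree[OF R0 p0] R \<open>p \<noteq> 0\<close> dR j
    by (simp add: fls_subdegree_poly_at_infinity)
  moreover have "?e R / ?e p \<noteq> 0" using R0 p0 by simp
  ultimately have "fls_nth (?e R / ?e p) (int j + 1) \<noteq> 0"
    by (metis nth_fls_subdegree_nonzero)
  moreover have "fls_nth (?e f * ?E) (int j + 1) = 0"
    using zero[OF j(1)] by (simp add: fls_nth_poly_at_infinity_mult algebra_simps)
  ultimately show False
    unfolding eq by (simp add: fls_nth_poly_at_infinity)
qed

section \<open>Orthogonality and uniqueness\<close>

text \<open>
  Since \<open>L\<close> inverts \<open>K\<close>, the product \<open>L H\<close> equals \<open>J K\<^sup>T\<close>, which is upper triangular. Thus the last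
  row of \<open>L\<close> is orthogonal, for the bilinear form of \<open>H\<close>, to all but the last standard basis vector.
\<close>

lemma last_row_inverse_factor_orthogonal:
  fixes J K L H :: "real mat"
  assumes J: "J \<in> carrier_mat n n" "signature_mat J"
    and K: "K \<in> carrier_mat n n" "lower_triangular K"
    and H: "H = K * J * transpose_mat K"
    and L: "L \<in> carrier_mat n n" "inverts_mat L K"
    and j: "j < n - 1"
  shows "(\<Sum>i<n. L $$ (n - 1, i) * H $$ (i, j)) = 0"
proof -
  let ?T = "transpose_mat K"
  have T: "?T \<in> carrier_mat n n" using K by simp
  have Hc: "H \<in> carrier_mat n n" using H J K T by auto
  have LK: "L * K = 1\<^sub>m n" using L by (auto simp: inverts_mat_def)
  have "L * H = (L * K) * (J * ?T)"
    unfolding H using L K J T by (simp add: assoc_mult_mat[of _ n n _ n _ n])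
  also have "\<dots> = J * ?T" unfolding LK using J T by simp
  finally have eq: "L * H = J * ?T" .
  have "(\<Sum>i<n. L $$ (n - 1, i) * H $$ (i, j)) = (L * H) $$ (n - 1, j)"
    using L Hc j by (auto simp: scalar_prod_def lessThan_atLeast0 intro!: sum.cong)
  also have "\<dots> = (\<Sum>i<n. J $$ (n - 1, i) * K $$ (j, i))"
    unfolding eq using J K j by (auto simp: scalar_prod_def lessThan_atLeast0 intro!: sum.cong)
  also have "\<dots> = 0"
  proof (intro sum.neutral ballI)
    fix i assume i: "i \<in> {..<n}"
    show "J $$ (n - 1, i) * K $$ (j, i) = 0"
    proof (cases "i = n - 1")
      case True
      then have "K $$ (j, i) = 0"
        using K j by (auto simp: lower_triangular_def upper_triangular_def)
      then show ?thesis by simp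
    next
      case False
      then have "J $$ (n - 1, i) = 0"
        using J i j by (auto simp: signature_mat_def diagonal_mat_def)
      then show ?thesis by simp
    qed
  qed
  finally show ?thesis .
qed

text \<open>
  Modulo \<open>p\<close>, evaluating \<open>f g q\<close> in two ways gives \<open>d f = c g\<close>; the degree bounds turn this congruence
  into an equality, and the leading coefficients give \<open>c = d\<close>.
\<close>

lemma monic_unique_of_constant_product:
  fixes p q f g :: "'a :: field poly"
  assumes "monic f" "monic g" "degree f < degree p" "degree g < degree p"
    and f: "p dvd f * q - [:c:]" and g: "p dvd g * q - [:d:]" and "d \<noteq> 0"
  shows "f = g"
proof -
  have "smult d f - smult c g = g * (f * q - [:c:]) - f * (g * q - [:d:])"
    by (simp add: algebra_simps)
  then have "p dvd smult d f - smult c g" using f g by (simp only: dvd_diff dvd_mult)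
  moreover have "degree (smult d f - smult c g) < degree p"
    using assms by (intro degree_diff_less) (auto intro: le_less_trans[OF degree_smult_le])
  ultimately have "smult d f - smult c g = 0"
    using dvd_imp_degree_le leD by blast
  then have eq: "smult d f = smult c g" by simp
  then have "lead_coeff (smult d f) = lead_coeff (smult c g)" by simp
  then have "d = c" using assms by (simp only: lead_coeff_smult) simp
  then show ?thesis using eq \<open>d \<noteq> 0\<close> smult_cancel by blast
qed

section \<open>The dual matrix\<close>

theorem theorem2p5:
  fixes p q q' :: "real poly" and n :: nat and J K L :: "real mat"
  assumes "n \<ge> 1" and "degree p = n" and "monic p" and "degree q = n - 1" and "monic q"
    and "no_degree_breakdown p q"
    and "J \<in> carrier_mat n n" and "signature_mat J"
    and "K \<in> carrier_mat n n" and "lower_triangular K"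
    and "hankel_mat n q p = K * J * transpose_mat K"
    and L_inverse_of_K: "L \<in> carrier_mat n n" "inverts_mat K L" "inverts_mat L K"
    and "monic q'" and "degree q' < n"
    and "\<exists>c. \<forall>j<n. coeff q' j = c * L $$ (n - 1, j)"
  shows "no_degree_breakdown p q' \<and> no_degree_breakdown p (dual_poly p q) \<and>
    Td p q' = dual_Td p q"
proof -
  let ?e = "seq_eps p q" and ?b = "seq_beta p q" and ?H = "hankel_mat n q p"
  define c where "c k = ?e k * (?b k)\<^sup>2" for k
  define r where "r = jacobi_poly (seq_alpha p q) c"
  obtain P where P: "P 0 = p" "P 1 = q" "P n = 1" "P (Suc n) = 0"
    and rec: "\<And>k. k < n \<Longrightarrow> P k = [:- seq_alpha p q (Suc k), 1:] * P (Suc k)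
       - smult (c (Suc k)) (P (Suc (Suc k)))"
    and eb: "\<And>k. k \<in> {1..<n} \<Longrightarrow> ?e k \<in> {-1, 1} \<and> ?b k > 0"
    by (rule no_degree_breakdown_recurrence[OF assms(1-6), folded c_def]) blast
  have rn: "r n = p" and rq: "p dvd r (n - 1) * q - [:\<Prod>i=1..n-1. c i:]"
    using jacobi_poly_duality[of n P "seq_alpha p q" c, OF rec] P \<open>n \<ge> 1\<close> by (auto simp: r_def)
  have dual: "dual_poly p q = r (n - 1)"
    using \<open>degree p = n\<close>
    by (simp add: dual_poly_def Td_def mat_delete_tridiag char_poly_tridiag r_def c_def[abs_def]
        power2_eq_square mult_ac)
  have nb: "no_degree_breakdown p (dual_poly p q)"
    using jacobi_poly_no_degree_breakdown[of n ?e ?b "seq_alpha p q", OF \<open>n \<ge> 1\<close> eb]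
    unfolding dual c_def[abs_def, symmetric] r_def[symmetric] rn by simp
  obtain \<mu> where \<mu>: "\<And>j. j < n \<Longrightarrow> coeff q' j = \<mu> * L $$ (n - 1, j)" using assms by blast
  have "(\<Sum>i\<le>degree q'. coeff q' i * fls_nth (expansion_at_infinity q p) (int (i + j) + 1)) = 0"
    if j: "j < n - 1" for j
  proof -
    have "(\<Sum>i\<le>degree q'. coeff q' i * fls_nth (expansion_at_infinity q p) (int (i + j) + 1))
        = (\<Sum>i<n. coeff q' i * fls_nth (expansion_at_infinity q p) (int (i + j) + 1))"
      using \<open>degree q' < n\<close> by (intro sum.mono_neutral_left) (auto simp: coeff_eq_0)
    also have "\<dots> = \<mu> * (\<Sum>i<n. L $$ (n - 1, i) * ?H $$ (i, j))"
      unfolding sum_distrib_left using j by (intro sum.cong) (auto simp: \<mu> hankel_mat_def)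
    also have "\<dots> = 0"
      using last_row_inverse_factor_orthogonal[of J n K ?H L j] assms j by simp
    finally show ?thesis .
  qed
  then have "degree ((q' * q) mod p) = 0"
    using \<open>degree p = n\<close> \<open>monic p\<close> by (intro product_mod_constant_of_vanishing_moments) auto
  then obtain d where d: "(q' * q) mod p = [:d:]" by (metis degree_0_id)
  have q'q: "p dvd q' * q - [:d:]" unfolding d[symmetric] by (rule dvd_minus_mod)
  have "(\<Prod>i=1..n-1. c i) \<noteq> 0" using eb by (fastforce simp: c_def)
  then have "q' = dual_poly p q"
    unfolding dual
  proof (intro monic_unique_of_constant_product[OF _ _ _ _ q'q rq])
    show "degree q' < degree p" "degree (r (n - 1)) < degree p"
      using assms jacobi_poly_degree_monic[of "seq_alpha p q" c "n - 1"] by (simp_all add: r_def)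
    show "monic (r (n - 1))"
      unfolding r_def using jacobi_poly_degree_monic by blast
  qed (use \<open>monic q'\<close> in auto)
  then show ?thesis using nb by (simp add: dual_Td_def)
qed

end
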